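(* Every finite metric space $(X,d)$ with $|X|\ge2$ and pairwise distinct distances has a farthest neighbour representation in the Euclidean plane $\mathbb{E}_2$, i.e. there is an injective map $f:X\to\mathbb{R}^2$ such that for every $x\in X$ the point $f(\mathrm{fn}(x))$ is the unique point of $f[X]\setminus\{f(x)\}$ at maximal Euclidean distance from $f(x)$.
   Context: Pairwise distinct distances means $d(x,y)=d(x',y')>0$ implies $\{x,y\}=\{x',y'\}$. For $x\in X$, $\mathrm{fn}(x)$ (the farthest neighbour of $x$) is the unique $y\in X\setminus\{x\}$ maximizing $d(x,y)$. *)

theory Defs
  imports "HOL-Analysis.Analysis"
begin

definition pairwise_distinct_distances :: "'a set \<Rightarrow> ('a \<Rightarrow> 'a \<Rightarrow> real) \<Rightarrow> bool" where
  "pairwise_distinct_distances X d \<longleftrightarrow>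
     (\<forall>x\<in>X. \<forall>y\<in>X. \<forall>x'\<in>X. \<forall>y'\<in>X.
        d x y = d x' y' \<and> d x y > 0 \<longrightarrow> {x, y} = {x', y'})"

definition is_farthest :: "'a set \<Rightarrow> ('a \<Rightarrow> 'a \<Rightarrow> real) \<Rightarrow> 'a \<Rightarrow> 'a \<Rightarrow> bool" where
  "is_farthest X d x y \<longleftrightarrow> is_arg_max (d x) (\<lambda>z. z \<in> X - {x}) y"

definition fn :: "'a set \<Rightarrow> ('a \<Rightarrow> 'a \<Rightarrow> real) \<Rightarrow> 'a \<Rightarrow> 'a" where
  "fn X d x = (THE y. is_farthest X d x y)"

text \<open>The description in \<^const>\<open>fn\<close> is well defined for the spaces under consideration.\<close>

lemma ex1_is_farthest:
  assumes "Metric_space X d" "finite X" "card X \<ge> 2" "pairwise_distinct_distances X d" "x \<in> X"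
  shows "\<exists>!y. is_farthest X d x y"
proof -
  interpret Metric_space X d by fact
  have "X - {x} \<noteq> {}"
  proof
    assume "X - {x} = {}"
    then have "X = {x}" using assms(5) by auto
    then show False using assms(3) by simp
  qed
  moreover have "finite (X - {x})" using assms(2) by simp
  ultimately obtain y where "is_arg_min (\<lambda>z. - d x z) (\<lambda>z. z \<in> X - {x}) y"
    using ex_is_arg_min_if_finite by blast
  then have y0: "is_arg_max (d x) (\<lambda>z. z \<in> X - {x}) y"
    by (simp add: is_arg_min_def is_arg_max_def)
  then have y: "y \<in> X - {x}" "\<And>z. z \<in> X - {x} \<Longrightarrow> d x z \<le> d x y"
    by (simp_all add: is_arg_max_linorder)
  have "is_farthest X d x y"
    using y0 by (simp add: is_farthest_def)
  moreover have "z = y" if "is_farthest X d x z" for z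
  proof -
    have z1: "z \<in> X - {x}" and "d x y \<le> d x z"
      using that y(1) by (simp_all add: is_farthest_def is_arg_max_linorder)
    then have z: "z \<in> X - {x}" "d x z = d x y" using y(2)[OF z1] by simp_all
    have "d x z > 0" using z(1) assms(5) mdist_pos_less[of x z] by blast
    moreover have "d x z = d x y \<and> d x z > 0 \<longrightarrow> {x, z} = {x, y}"
      using assms(4)[unfolded pairwise_distinct_distances_def, rule_format, of x z x y] assms(5)
        y(1) z(1) by blast
    ultimately have "{x, z} = {x, y}" using z(2) by blast
    then show ?thesis using y(1) z(1) unfolding doubleton_eq_iff by blast
  qed
  ultimately show ?thesis by blast
qed

definition farthest_neighbour_representation ::
    "'a set \<Rightarrow> ('a \<Rightarrow> 'a \<Rightarrow> real) \<Rightarrow> ('a \<Rightarrow> 'b::metric_space) \<Rightarrow> bool" where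
  "farthest_neighbour_representation X d f \<longleftrightarrow>
     inj_on f X \<and>
     (\<forall>x\<in>X. \<forall>p. is_farthest (f ` X) dist (f x) p \<longleftrightarrow> p = f (fn X d x))"

end

theory Submission
  imports Defs
begin

text \<open>
  Let \<open>g\<close> be the farthest neighbour map. Since the distance from \<open>x\<close> to \<open>g x\<close> grows along orbits
  of \<open>g\<close>, every cycle of \<open>g\<close> is a 2-cycle, so \<open>X\<close> arises from the union of the 2-cycles by
  successively adding elements \<open>x\<close> with \<open>g x\<close> already present.

  The points are placed in two clusters around \<open>(-A, 0)\<close> and \<open>(A, 0)\<close>, each \<open>x\<close> being opposite to
  \<open>g x\<close>. A point with vertical offset \<open>t x\<close> and a horizontal offset of order \<open>1 / A\<close> has, as
  \<open>A\<close> tends to infinity, its farthest neighbour at the \<open>y\<close> of the opposite cluster maximising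
  \<open>c y + t x * t y\<close>, where \<open>c y\<close> can be prescribed freely. Hence it suffices to find lines
  \<open>s \<mapsto> c y + s * t y\<close> such that at \<open>s = t x\<close> the line of \<open>g x\<close> is strictly the highest of its side.
  A new line of fresh slope can always be inserted so that it becomes the highest one somewhere
  without disturbing the winners at finitely many given places. Requiring every line to win
  somewhere therefore lets the construction proceed by induction.
\<close>

section \<open>Inserting a line into an upper envelope\<close>

text \<open>Raise a line of slope \<open>T\<close> until it first meets a winner at a place of
  \<open>S\<close>. Since the two slopes differ, the line crosses that winner there and exceeds it
  on one side. A short step to that side and a slight lowering of the line give both strict
  inequalities.\<close>

lemma insert_line_into_envelope:
  fixes c t :: "'a \<Rightarrow> real" and b :: "real \<Rightarrow> 'a"
  assumes "finite B" "finite S" "S \<noteq> {}" "T \<notin> t ` B"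
    and b: "\<And>s. s \<in> S \<Longrightarrow> b s \<in> B"
    and win: "\<And>s u. s \<in> S \<Longrightarrow> u \<in> B \<Longrightarrow> u \<noteq> b s \<Longrightarrow> c u + s * t u < c (b s) + s * t (b s)"
  obtains C r where "\<And>s. s \<in> S \<Longrightarrow> C + s * T < c (b s) + s * t (b s)"
    and "\<And>u. u \<in> B \<Longrightarrow> c u + r * t u < C + r * T"
proof -
  \<comment> \<open>\<open>F s\<close> is the intercept at which a line of slope \<open>T\<close>
    meets the winner at \<open>s\<close>, so any \<open>C\<close> below the minimum of
    \<open>F\<close> leaves all winners on \<open>S\<close> in place.\<close>
  define F where "F = (\<lambda>s. c (b s) + s * t (b s) - s * T)"
  obtain s0 where s0: "s0 \<in> S" "\<And>s. s \<in> S \<Longrightarrow> F s0 \<le> F s"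
    using ex_min_if_finite[of "F ` S"] assms(2,3) by (force simp: not_less)
  \<comment> \<open>The sign of \<open>h\<close> tells on which side of \<open>s0\<close> to search:
    at \<open>s0 - \<delta> * h\<close> the line with intercept \<open>F s0\<close> exceeds that of
    \<open>b s0\<close> by \<open>\<delta> * h * h\<close>. All other lines are strictly lower at
    \<open>s0\<close> and stay so for small \<delta>.\<close>
  define h where "h = t (b s0) - T"
  have h: "h \<noteq> 0"
    using assms(4) b[OF s0(1)] by (auto simp: h_def)
  have "\<forall>\<^sub>F \<delta> in at_right 0. c u + (s0 - \<delta> * h) * (t u - T) < F s0" if u: "u \<in> B" for u
  proof (cases "u = b s0")
    case True
    have "c u + (s0 - \<delta> * h) * (t u - T) < F s0" if "\<delta> > 0" for \<delta> :: real
    proof -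
      have "\<delta> * (h * h) > 0" using that h by (auto simp: zero_less_mult_iff linorder_neq_iff)
      then show ?thesis unfolding F_def True h_def by (simp add: algebra_simps)
    qed
    then show ?thesis
      by (auto intro: eventually_mono[OF eventually_at_right_less])
  next
    case False
    have "((\<lambda>\<delta>. c u + (s0 - \<delta> * h) * (t u - T)) \<longlongrightarrow> c u + (s0 - 0 * h) * (t u - T)) (at_right 0)"
      by (intro tendsto_intros)
    moreover have "c u + (s0 - 0 * h) * (t u - T) < F s0"
      using win[OF s0(1) u False] by (simp add: F_def algebra_simps)
    ultimately show ?thesis by (rule order_tendstoD)
  qed
  then have "\<forall>\<^sub>F \<delta> in at_right 0. \<forall>u\<in>B. c u + (s0 - \<delta> * h) * (t u - T) < F s0"
    using \<open>finite B\<close> by (simp add: eventually_ball_finite)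
  then obtain \<delta> where \<delta>: "\<And>u. u \<in> B \<Longrightarrow> c u + (s0 - \<delta> * h) * (t u - T) < F s0"
    using eventually_happens'[OF trivial_limit_at_right_real] by blast
  define r where "r = s0 - \<delta> * h"
  have "\<exists>C. (\<forall>u\<in>B. c u + r * (t u - T) < C) \<and> C < F s0"
  proof -
    have "\<forall>\<^sub>F C in at_left (F s0). \<forall>u\<in>B. c u + r * (t u - T) < C"
      using \<open>finite B\<close> \<delta>
      by (intro eventually_ball_finite)
         (auto simp: r_def intro!: eventually_at_leftI eventually_mono[OF eventually_at_left_real])
    moreover have "\<forall>\<^sub>F C in at_left (F s0). C < F s0"
      by (simp add: eventually_at_filter)
    ultimately have "\<forall>\<^sub>F C in at_left (F s0). (\<forall>u\<in>B. c u + r * (t u - T) < C) \<and> C < F s0"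
      by (rule eventually_conj)
    then show ?thesis
      using eventually_happens'[OF trivial_limit_at_left_real] by blast
  qed
  then obtain C where C: "\<And>u. u \<in> B \<Longrightarrow> c u + r * (t u - T) < C" "C < F s0"
    by blast
  show thesis
  proof
    show "C + s * T < c (b s) + s * t (b s)" if "s \<in> S" for s
      using s0(2)[OF that] C(2) by (simp add: F_def)
    show "c u + r * t u < C + r * T" if "u \<in> B" for u
      using C(1)[OF that] by (simp add: algebra_simps)
  qed
qed

section \<open>Line systems for the farthest neighbour map\<close>

text \<open>The number \<open>t x\<close> is both the slope of the line of \<open>x\<close> and the
  place where \<open>x\<close> compares the lines of the other side. The last clause serves the
  induction: a later element mapped to \<open>v\<close> can take a slope near
  \<open>r v\<close>.\<close>

definition line_system ::
    "'a set \<Rightarrow> ('a \<Rightarrow> 'a) \<Rightarrow> ('a \<Rightarrow> bool) \<Rightarrow> ('a \<Rightarrow> real) \<Rightarrow> ('a \<Rightarrow> real) \<Rightarrow> ('a \<Rightarrow> real) \<Rightarrow> bool"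
where
  "line_system A g side t c r \<longleftrightarrow>
     (\<forall>x\<in>A. side (g x) \<noteq> side x) \<and>
     (\<forall>x\<in>A. \<forall>y\<in>A. side y = side (g x) \<longrightarrow> y \<noteq> g x \<longrightarrow>
        c y + t x * t y < c (g x) + t x * t (g x)) \<and>
     (\<forall>v\<in>A. \<forall>u\<in>A. side u = side v \<longrightarrow> u \<noteq> v \<longrightarrow> c u + r v * t u < c v + r v * t v)"

text \<open>The element \<open>x\<close> joins the side opposite to \<open>g x\<close>, with a slope
  close to \<open>r (g x)\<close>, so that \<open>g x\<close> wins where \<open>x\<close> looks. The
  envelope lemma then supplies its intercept and its own winning place.\<close>

lemma line_system_insert:
  assumes sys: "line_system A g side t c r" and "finite A" "g ` A \<subseteq> A" "x \<notin> A" "g x \<in> A"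
  shows "\<exists>side t c r. line_system (insert x A) g side t c r"
proof -
  have sd: "side (g y) \<noteq> side y" if "y \<in> A" for y
    using sys that by (auto simp: line_system_def)
  have opp: "c z + t y * t z < c (g y) + t y * t (g y)"
    if "y \<in> A" "z \<in> A" "side z = side (g y)" "z \<noteq> g y" for y z
    using sys that by (auto simp: line_system_def)
  have wit: "c u + r v * t u < c v + r v * t v"
    if "v \<in> A" "u \<in> A" "side u = side v" "u \<noteq> v" for u v
    using sys that by (auto simp: line_system_def)
  have gA: "g y \<in> A" if "y \<in> A" for y
    using assms(3) that by auto
  define v where "v = g x"
  have v: "v \<in> A" using assms by (simp add: v_def)
  define B where "B = {u \<in> A. side u \<noteq> side v}"
  define D where "D = {u \<in> A. side u = side v}"
  have fin: "finite B" "finite D" using \<open>finite A\<close> by (auto simp: B_def D_def)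
  \<comment> \<open>Winning strictly is an open condition, so \<open>v\<close> still wins slightly
    to the right of \<open>r v\<close>; this freedom lets \<open>T\<close> avoid the finitely many
    slopes of \<open>B\<close>.\<close>
  have "\<forall>\<^sub>F T in at_right (r v). \<forall>y\<in>D - {v}. c y + T * t y < c v + T * t v"
  proof (intro eventually_ball_finite ballI)
    fix y assume y: "y \<in> D - {v}"
    have "((\<lambda>T. c v + T * t v - (c y + T * t y)) \<longlongrightarrow> c v + r v * t v - (c y + r v * t y))
        (at_right (r v))"
      by (intro tendsto_intros)
    moreover have "c v + r v * t v - (c y + r v * t y) > 0"
      using wit[of v y] y v by (auto simp: D_def)
    ultimately have "\<forall>\<^sub>F T in at_right (r v). c v + T * t v - (c y + T * t y) > 0"
      by (rule order_tendstoD)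
    then show "\<forall>\<^sub>F T in at_right (r v). c y + T * t y < c v + T * t v"
      by eventually_elim simp
  qed (use fin in auto)
  moreover have "\<forall>\<^sub>F T in at_right (r v). \<forall>a\<in>t ` B. T \<noteq> a"
    using fin by (intro eventually_ball_finite ballI)
      (auto intro: eventually_neq_at_within)
  ultimately have "\<forall>\<^sub>F T in at_right (r v).
      (\<forall>y\<in>D - {v}. c y + T * t y < c v + T * t v) \<and> (\<forall>a\<in>t ` B. T \<noteq> a)"
    by (rule eventually_conj)
  then obtain T where T: "\<And>y. y \<in> D \<Longrightarrow> y \<noteq> v \<Longrightarrow> c y + T * t y < c v + T * t v" "T \<notin> t ` B"
    using eventually_happens'[OF trivial_limit_at_right_real] by blast
  \<comment> \<open>All places where the winner among \<open>B\<close> is prescribed: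
    \<open>g y\<close> at \<open>t y\<close>, and \<open>u\<close> at \<open>r u\<close>. Such
    places may coincide, but strict winners are unique, so one function \<open>b\<close> covers both
    kinds.\<close>
  define S where "S = t ` D \<union> r ` B"
  define W where "W = (\<lambda>s b. b \<in> B \<and> (\<forall>u\<in>B. u \<noteq> b \<longrightarrow> c u + s * t u < c b + s * t b))"
  define b where "b = (\<lambda>s. SOME b. W s b)"
  have W1: "W (t y) (g y)" if "y \<in> D" for y
    using that opp[of y] sd[of y] gA[of y] by (auto simp: W_def D_def B_def)
  have W2: "W (r u) u" if "u \<in> B" for u
    using that wit[of u] by (auto simp: W_def B_def)
  have Wb: "W s (b s)" if "s \<in> S" for s
    using that W1 W2 someI[of "W s"] unfolding b_def S_def by blast
  have W_unique: "u = u'" if "W s u" "W s u'" for s u u'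
  proof (rule ccontr)
    assume "u \<noteq> u'"
    then have "c u + s * t u < c u' + s * t u'" "c u' + s * t u' < c u + s * t u"
      using that by (auto simp: W_def)
    then show False by simp
  qed
  have Snz: "S \<noteq> {}" using v by (auto simp: S_def D_def)
  obtain C \<rho> where C: "\<And>s. s \<in> S \<Longrightarrow> C + s * T < c (b s) + s * t (b s)"
    and \<rho>: "\<And>u. u \<in> B \<Longrightarrow> c u + \<rho> * t u < C + \<rho> * T"
  proof (rule insert_line_into_envelope[of B S T t b c])
    show "finite S" using fin by (simp add: S_def)
  qed (use fin Snz T(2) Wb in \<open>auto simp: W_def\<close>)
  have C1: "C + t y * T < c (g y) + t y * t (g y)" if "y \<in> D" for y
  proof -
    have "t y \<in> S" using that by (simp add: S_def)
    then show ?thesis using C[of "t y"] W_unique[OF Wb W1[OF that]] by simp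
  qed
  have C2: "C + r u * T < c u + r u * t u" if "u \<in> B" for u
  proof -
    have "r u \<in> S" using that by (simp add: S_def)
    then show ?thesis using C[of "r u"] W_unique[OF Wb W2[OF that]] by simp
  qed
  have ne: "y \<noteq> x" if "y \<in> A" for y using that \<open>x \<notin> A\<close> by auto
  have gx: "g x = v" by (simp add: v_def)
  \<comment> \<open>The side \<open>D\<close> gains no line, so there only the new place
    \<open>T\<close> matters; on side \<open>B\<close> the old winners survive by \<open>C1\<close>
    and \<open>C2\<close>, and \<open>x\<close> wins at \<rho>.\<close>
  have "line_system (insert x A) g (side(x := \<not> side v)) (t(x := T)) (c(x := C)) (r(x := \<rho>))"
    unfolding line_system_def
  proof (intro conjI ballI impI, goal_cases)
    case (1 y)
    then show ?case using sd gA ne v gx by (cases "y = x") auto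
  next
    case (2 y z)
    show ?case
    proof (cases "y = x")
      case True
      then show ?thesis using 2 T(1)[of z] gx ne[OF v] v by (auto simp: D_def split: if_splits)
    next
      case False
      then have y: "y \<in> A" using 2 by auto
      show ?thesis
      proof (cases "z = x")
        case True
        then have "y \<in> D" using 2 False y sd[OF y] ne[OF gA[OF y]] by (auto simp: D_def)
        then show ?thesis using C1[of y] True False ne[OF gA[OF y]] by simp
      next
        case z: False
        then show ?thesis using 2 opp[OF y, of z] False ne[OF gA[OF y]] by auto
      qed
    qed
  next
    case (3 w u)
    then show ?case using C2[of w] \<rho>[of u] wit[of w u]
      by (cases "w = x"; cases "u = x") (auto simp: B_def)
  qed
  then show ?thesis by blast
qed

text \<open>The base of the induction. The lines are tangents to the parabola
  \<open>s\<^sup>2 / 2\<close>, each strictly highest at its own slope. Partners share a slope, so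
  each wins exactly where the other looks.\<close>

lemma line_system_two_cycles:
  assumes "finite A" "g ` A \<subseteq> A" "\<And>x. x \<in> A \<Longrightarrow> g x \<noteq> x" "\<And>x. x \<in> A \<Longrightarrow> g (g x) = x"
  shows "\<exists>side t c r. line_system A g side t c r"
proof -
  obtain e :: "'a \<Rightarrow> nat" where e: "inj_on e A"
    using finite_imp_inj_to_nat_seg[OF \<open>finite A\<close>] by blast
  \<comment> \<open>The numbering \<open>e\<close> splits every 2-cycle between the sides, and its
    smaller number is the common slope, so slopes are distinct within a side.\<close>
  define side where "side = (\<lambda>x. e x < e (g x))"
  define t where "t = (\<lambda>x. real (min (e x) (e (g x))))"
  define c where "c = (\<lambda>x. - (t x)\<^sup>2 / 2)"
  have gA: "g y \<in> A" if "y \<in> A" for y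
    using assms(2) that by auto
  have eg: "e x \<noteq> e (g x)" if "x \<in> A" for x
    using e assms(3)[OF that] gA[OF that] that by (metis inj_onD)
  have sd: "side (g x) \<noteq> side x" if "x \<in> A" for x
    using eg[OF that] assms(4)[OF that] by (auto simp: side_def)
  have tg: "t (g x) = t x" if "x \<in> A" for x
    using assms(4)[OF that] by (simp add: t_def min.commute)
  have tinj: "u = v" if "u \<in> A" "v \<in> A" "side u = side v" "t u = t v" for u v
  proof (cases "side u")
    case True
    then have "e u = e v" using that by (auto simp: side_def t_def)
    then show ?thesis using e that by (auto dest: inj_onD)
  next
    case False
    then have "e (g u) = e (g v)" using that eg[of u] eg[of v] by (auto simp: side_def t_def min_def split: if_splits)
    then have "g u = g v" using e that gA by (auto dest: inj_onD)
    then show ?thesis using assms(4) that by metis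
  qed
  have key: "c u + t v * t u < c v + t v * t v" if "t u \<noteq> t v" for u v
  proof -
    have "(t u - t v)\<^sup>2 > 0" using that by simp
    then show ?thesis by (simp add: c_def power2_eq_square algebra_simps)
  qed
  have "line_system A g side t c t"
    unfolding line_system_def
  proof (intro conjI ballI impI)
    fix x y assume "x \<in> A" "y \<in> A" "side y = side (g x)" "y \<noteq> g x"
    then show "c y + t x * t y < c (g x) + t x * t (g x)"
      using key[of y "g x"] tinj[of y "g x"] tg[of x] gA[of x] by auto
  qed (use sd tinj key in blast)+
  then show ?thesis by blast
qed

text \<open>The weight \<open>w\<close> dictates the order of insertion: starting from the 2-cycles,
  an element of largest weight among those missing is added next.\<close>

lemma ex_line_system:
  fixes w :: "'a \<Rightarrow> real"
  assumes "finite X" "g ` X \<subseteq> X" "\<And>x. x \<in> X \<Longrightarrow> g x \<noteq> x"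
    and mono: "\<And>x. x \<in> X \<Longrightarrow> w x \<le> w (g x)"
    and strict: "\<And>x. x \<in> X \<Longrightarrow> w x = w (g x) \<Longrightarrow> g (g x) = x"
  shows "\<exists>side t c r. line_system X g side t c r"
proof -
  define K where "K = {x \<in> X. g (g x) = x}"
  define P where "P = (\<lambda>A. K \<subseteq> A \<and> A \<subseteq> X \<and> g ` A \<subseteq> A \<and>
    (\<exists>side t c r. line_system A g side t c r))"
  have "P K"
  proof -
    have "finite K" "g ` K \<subseteq> K" using assms(1,2) by (auto simp: K_def)
    moreover from this have "\<exists>side t c r. line_system K g side t c r"
      by (intro line_system_two_cycles) (use assms(3) in \<open>auto simp: K_def\<close>)
    ultimately show ?thesis unfolding P_def by (auto simp: K_def)
  qed
  moreover have "finite {A. P A}"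
    by (rule finite_subset[of _ "Pow X"]) (use assms(1) in \<open>auto simp: P_def\<close>)
  ultimately obtain A where A: "P A" and max: "\<And>A'. P A' \<Longrightarrow> A \<subseteq> A' \<Longrightarrow> A = A'"
    using finite_has_maximal[of "{A. P A}"] by blast
  have "A = X"
  proof (rule ccontr)
    assume "A \<noteq> X"
    then have "X - A \<noteq> {}" using A by (auto simp: P_def)
    then obtain x where x: "x \<in> X - A" "\<And>y. y \<in> X - A \<Longrightarrow> w y \<le> w x"
      using ex_min_if_finite[of "(\<lambda>x. - w x) ` (X - A)"] assms(1) by (force simp: not_less)
    have "g x \<in> A"
    proof (rule ccontr)
      assume "g x \<notin> A"
      then have "w (g x) \<le> w x" using x assms(2) by auto
      then have "x \<in> K" using mono[of x] strict[of x] x by (auto simp: K_def)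
      then show False using A x by (auto simp: P_def)
    qed
    moreover have "finite A" using A assms(1) finite_subset by (auto simp: P_def)
    moreover obtain side t c r where "line_system A g side t c r" "g ` A \<subseteq> A"
      using A unfolding P_def by blast
    ultimately have "\<exists>side t c r. line_system (insert x A) g side t c r"
      using x(1) by (intro line_system_insert[of A g side t c r x]) auto
    moreover have "K \<subseteq> insert x A" "insert x A \<subseteq> X" "g ` insert x A \<subseteq> insert x A"
      using A x(1) \<open>g x \<in> A\<close> by (auto simp: P_def)
    ultimately have "P (insert x A)"
      unfolding P_def by (intro conjI)
    then show False using max[of "insert x A"] x by auto
  qed
  then show ?thesis using A by (auto simp: P_def)
qed

section \<open>Realising a line system by points in the plane\<close>

lemma dist_vector_2:
  "dist (vector [a, b] :: real ^ 2) (vector [a', b']) = sqrt ((a - a')\<^sup>2 + (b - b')\<^sup>2)"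
  by (simp add: dist_vec_def L2_set_def sum_2 dist_real_def)

text \<open>Each of the finitely many strict inequalities holds for all large \<open>A\<close>, so a
  single \<open>A\<close> satisfies them all.\<close>

lemma line_system_representation:
  assumes sys: "line_system X g side t c r" and "finite X"
  obtains f :: "'a \<Rightarrow> real ^ 2" where "inj_on f X"
    and "\<And>x y. x \<in> X \<Longrightarrow> y \<in> X \<Longrightarrow> y \<noteq> g x \<Longrightarrow> dist (f x) (f y) < dist (f x) (f (g x))"
proof -
  have sd: "side (g y) \<noteq> side y" if "y \<in> X" for y
    using sys that by (auto simp: line_system_def)
  have opp: "c z + t y * t z < c (g y) + t y * t (g y)"
    if "y \<in> X" "z \<in> X" "side z = side (g y)" "z \<noteq> g y" for y z
    using sys that by (auto simp: line_system_def)
  \<comment> \<open>Of two parallel lines the higher one is higher everywhere, so both cannot win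
    somewhere. This later separates points of the same cluster.\<close>
  have tinj: "u = v" if "u \<in> X" "v \<in> X" "side u = side v" "t u = t v" for u v
  proof (rule ccontr)
    assume "u \<noteq> v"
    then have "c u + r v * t u < c v + r v * t v" "c v + r u * t v < c u + r u * t u"
      using sys that unfolding line_system_def by metis+
    then show False using that(4) by simp
  qed
  \<comment> \<open>Chosen so that the squared distance of opposite points is
    \<open>4 * A\<^sup>2 + 2 * (c x + c y + t x * t y) + O (1 / A\<^sup>2)\<close>.\<close>
  define q where "q = (\<lambda>x. ((t x)\<^sup>2 - 2 * c x) / 4)"
  define f :: "real \<Rightarrow> 'a \<Rightarrow> real ^ 2" where
    "f = (\<lambda>A x. if side x then vector [q x / A - A, t x] else vector [A - q x / A, - t x])"
  have same: "dist (f A x) (f A y) = sqrt (((q x - q y) / A)\<^sup>2 + (t x - t y)\<^sup>2)"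
    if "side x = side y" for A x y
    using that by (auto simp: f_def dist_vector_2 diff_divide_distrib power2_commute)
  have diff: "dist (f A x) (f A y) = sqrt ((2 * A - (q x + q y) / A)\<^sup>2 + (t x + t y)\<^sup>2)"
    if "side x \<noteq> side y" for A x y
    using that by (auto simp: f_def dist_vector_2 add_divide_distrib power2_eq_square algebra_simps)
  have small: "((\<lambda>A. (a / A)\<^sup>2) \<longlongrightarrow> 0) at_top" for a :: real
  proof -
    have "((\<lambda>A. a / A) \<longlongrightarrow> 0) at_top"
      by (intro tendsto_divide_0[OF tendsto_const] filterlim_at_top_imp_at_infinity filterlim_ident)
    from tendsto_power[OF this, of 2] show ?thesis by simp
  qed
  have square: "(2 * A - a / A)\<^sup>2 = 4 * A\<^sup>2 - 4 * a + (a / A)\<^sup>2" if "A > 0" for A a :: real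
    using that by (simp add: power2_eq_square field_simps)
  \<comment> \<open>Squared distances inside a cluster stay bounded, while those across grow like
    \<open>4 * A\<^sup>2\<close>.\<close>
  have far: "\<forall>\<^sub>F A in at_top. (a / A)\<^sup>2 + b < (2 * A - a' / A)\<^sup>2 + b'" for a b a' b' :: real
  proof -
    have "((\<lambda>A. - 4 * a' + (a' / A)\<^sup>2 + b' - ((a / A)\<^sup>2 + b)) \<longlongrightarrow> - 4 * a' + 0 + b' - (0 + b)) at_top"
      by (intro tendsto_intros small)
    moreover have "filterlim (\<lambda>A::real. 4 * A\<^sup>2) at_top at_top"
      by (intro filterlim_tendsto_pos_mult_at_top[OF tendsto_const] filterlim_pow_at_top
          filterlim_ident) auto
    ultimately have "filterlim (\<lambda>A. - 4 * a' + (a' / A)\<^sup>2 + b' - ((a / A)\<^sup>2 + b) + 4 * A\<^sup>2) at_top at_top"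
      by (rule filterlim_tendsto_add_at_top)
    then have "\<forall>\<^sub>F A in at_top. - 4 * a' + (a' / A)\<^sup>2 + b' - ((a / A)\<^sup>2 + b) + 4 * A\<^sup>2 > 0"
      unfolding filterlim_at_top_dense by blast
    then show ?thesis
      using eventually_gt_at_top[of 0] by eventually_elim (simp add: square)
  qed
  have "\<forall>\<^sub>F A in at_top. dist (f A x) (f A y) < dist (f A x) (f A (g x))"
    if x: "x \<in> X" and y: "y \<in> X" "y \<noteq> g x" for x y
  proof (cases "side y = side x")
    case True
    then show ?thesis using True sd[OF x] far by (simp add: same diff)
  next
    case False
    then have s: "side y = side (g x)" using sd[OF x] by auto
    \<comment> \<open>The common term \<open>4 * A\<^sup>2\<close> is cancelled; by the choice of
      \<open>q\<close> the limit is twice the gap between the lines of \<open>g x\<close> and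
      \<open>y\<close> at \<open>t x\<close>.\<close>
    have "((\<lambda>A. - 4 * (q x + q (g x)) + ((q x + q (g x)) / A)\<^sup>2 + (t x + t (g x))\<^sup>2
          - (- 4 * (q x + q y) + ((q x + q y) / A)\<^sup>2 + (t x + t y)\<^sup>2)) \<longlongrightarrow>
        - 4 * (q x + q (g x)) + 0 + (t x + t (g x))\<^sup>2
          - (- 4 * (q x + q y) + 0 + (t x + t y)\<^sup>2)) at_top"
      by (intro tendsto_intros small)
    moreover have "- 4 * (q x + q (g x)) + 0 + (t x + t (g x))\<^sup>2
        - (- 4 * (q x + q y) + 0 + (t x + t y)\<^sup>2) > 0"
      using opp[OF x y(1) s y(2)] by (simp add: q_def power2_eq_square field_simps)
    ultimately have "\<forall>\<^sub>F A in at_top.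
        - 4 * (q x + q (g x)) + ((q x + q (g x)) / A)\<^sup>2 + (t x + t (g x))\<^sup>2
        - (- 4 * (q x + q y) + ((q x + q y) / A)\<^sup>2 + (t x + t y)\<^sup>2) > 0"
      by (rule order_tendstoD)
    then show ?thesis
      using eventually_gt_at_top[of 0]
      by eventually_elim (use False sd[OF x] in \<open>simp add: diff square\<close>)
  qed
  then have "\<forall>\<^sub>F A in at_top. \<forall>x\<in>X. \<forall>y\<in>X - {g x}.
      dist (f A x) (f A y) < dist (f A x) (f A (g x))"
    using \<open>finite X\<close> by (intro eventually_ball_finite ballI) auto
  moreover have "\<forall>\<^sub>F A in at_top. \<forall>x\<in>X. \<forall>y\<in>X - {x}. f A x \<noteq> f A y"
  proof (intro eventually_ball_finite ballI)
    fix x y assume x: "x \<in> X" and y: "y \<in> X - {x}"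
    show "\<forall>\<^sub>F A in at_top. f A x \<noteq> f A y"
    proof (cases "side x = side y")
      case True
      then have "t x \<noteq> t y" using tinj x y by auto
      then have "dist (f A x) (f A y) > 0" for A
        using same[OF True] by (simp add: add_nonneg_pos)
      then show ?thesis by auto
    next
      case False
      have "\<forall>\<^sub>F A in at_top. dist (f A x) (f A y) > 0"
        using False far[of 0 0] by (simp add: diff)
      then show ?thesis by eventually_elim auto
    qed
  qed (use \<open>finite X\<close> in auto)
  ultimately have "\<forall>\<^sub>F A in at_top. (\<forall>x\<in>X. \<forall>y\<in>X - {g x}.
      dist (f A x) (f A y) < dist (f A x) (f A (g x))) \<and> (\<forall>x\<in>X. \<forall>y\<in>X - {x}. f A x \<noteq> f A y)"
    by (rule eventually_conj)
  then obtain A where "\<forall>x\<in>X. \<forall>y\<in>X - {g x}. dist (f A x) (f A y) < dist (f A x) (f A (g x))"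
    and "\<forall>x\<in>X. \<forall>y\<in>X - {x}. f A x \<noteq> f A y"
    using eventually_happens'[OF trivial_limit_at_top_linorder] by blast
  then show thesis
    using that[of "f A"] by (auto simp: inj_on_def)
qed

section \<open>Application to the farthest neighbour map\<close>

theorem theorem9:
  fixes X :: "'a set" and d :: "'a \<Rightarrow> 'a \<Rightarrow> real"
  assumes "Metric_space X d"
    and "finite X"
    and "card X \<ge> 2"
    and "pairwise_distinct_distances X d"
  shows "\<exists>f :: 'a \<Rightarrow> real ^ 2. farthest_neighbour_representation X d f"
proof -
  interpret Metric_space X d by fact
  define g where "g = fn X d"
  have "is_farthest X d x (g x)" if "x \<in> X" for x
    unfolding g_def fn_def using ex1_is_farthest[OF assms that] by (rule theI')
  then have g: "g x \<in> X" "g x \<noteq> x" and far: "\<And>z. z \<in> X \<Longrightarrow> z \<noteq> x \<Longrightarrow> d x z \<le> d x (g x)"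
    if "x \<in> X" for x
    using that by (auto simp: is_farthest_def is_arg_max_linorder)
  have gX: "g ` X \<subseteq> X" using g by auto
  have "\<exists>side t c r. line_system X g side t c r"
  \<comment> \<open>The weight cannot decrease along \<open>g\<close>, because \<open>x\<close>
    itself competes for the farthest neighbour of \<open>g x\<close>; distinctness of distances
    turns equality into a 2-cycle.\<close>
  proof (rule ex_line_system[where w = "\<lambda>x. d x (g x)"])
    fix x assume x: "x \<in> X"
    show "d x (g x) \<le> d (g x) (g (g x))"
      using far[of "g x" x] g[OF x] x by (metis commute)
    assume "d x (g x) = d (g x) (g (g x))"
    moreover have "d x (g x) > 0" using g[OF x] x by auto
    ultimately have "{x, g x} = {g x, g (g x)}"
      using assms(4) x g unfolding pairwise_distinct_distances_def by blast
    then show "g (g x) = x" using g x by (auto simp: doubleton_eq_iff)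
  qed (use \<open>finite X\<close> gX g in auto)
  then obtain side t c r where "line_system X g side t c r" by blast
  then obtain f :: "'a \<Rightarrow> real ^ 2" where f: "inj_on f X"
    and less: "\<And>x y. x \<in> X \<Longrightarrow> y \<in> X \<Longrightarrow> y \<noteq> g x \<Longrightarrow> dist (f x) (f y) < dist (f x) (f (g x))"
    using line_system_representation[OF _ \<open>finite X\<close>] by metis
  have "is_farthest (f ` X) dist (f x) p \<longleftrightarrow> p = f (g x)" if x: "x \<in> X" for x p
  proof
    have fg: "f (g x) \<in> f ` X - {f x}"
      using g[OF x] x f by (auto dest: inj_onD)
    show "p = f (g x)" if p: "is_farthest (f ` X) dist (f x) p"
    proof -
      obtain y where y: "y \<in> X" "p = f y" and "dist (f x) (f (g x)) \<le> dist (f x) (f y)"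
        using p fg by (auto simp: is_farthest_def is_arg_max_linorder)
      then show ?thesis using less[OF x y(1)] by force
    qed
    show "is_farthest (f ` X) dist (f x) p" if "p = f (g x)"
      using that fg less[OF x] by (force simp: is_farthest_def is_arg_max_linorder)
  qed
  then show ?thesis
    using f unfolding farthest_neighbour_representation_def g_def by blast
qed

end
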